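(* Let $G$ be a finite undirected graph with vertex set $\{v_1,\ldots,v_n\}$. Then the number of maximal clique-partitions of $G$ is at most $\prod_{i=1}^n d(v_i)$.
   Context: A clique of $G$ is a nonempty set of pairwise adjacent vertices; it is maximal if it is not a proper subset of another clique. For a vertex $v$, $d(v)$ denotes the number of maximal cliques of $G$ that contain $v$. A clique-partition of $G$ is a partition of the vertex set into cliques; it is maximal if it does not contain two different cliques $C,C'$ such that $C\cup C'$ is a clique. *)

theory Defs
  imports "Graph_Theory.Digraph" "HOL-Library.Disjoint_Sets"
begin

text \<open>
  An undirected graph is a \<^locale>\<open>graph\<close>: a finite symmetric digraph without loops and
  parallel arcs, so that each undirected edge is a pair of opposite arcs and
  \<open>u \<rightarrow>\<^bsub>G\<^esub> v\<close> is adjacency. \<^const>\<open>pairwise\<close> constrains only distinct elements.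
\<close>

definition clique :: "('a, 'b) pre_digraph \<Rightarrow> 'a set \<Rightarrow> bool" where
  "clique G C \<longleftrightarrow> C \<noteq> {} \<and> C \<subseteq> verts G \<and> pairwise (\<lambda>u v. u \<rightarrow>\<^bsub>G\<^esub> v) C"

definition maximal_clique :: "('a, 'b) pre_digraph \<Rightarrow> 'a set \<Rightarrow> bool" where
  "maximal_clique G C \<longleftrightarrow> clique G C \<and> \<not> (\<exists>D. clique G D \<and> C \<subset> D)"

definition num_maximal_cliques_at :: "('a, 'b) pre_digraph \<Rightarrow> 'a \<Rightarrow> nat" where
  "num_maximal_cliques_at G v = card {C. maximal_clique G C \<and> v \<in> C}"

definition clique_partition :: "('a, 'b) pre_digraph \<Rightarrow> 'a set set \<Rightarrow> bool" where
  "clique_partition G P \<longleftrightarrow> partition_on (verts G) P \<and> (\<forall>C\<in>P. clique G C)"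

definition maximal_clique_partition :: "('a, 'b) pre_digraph \<Rightarrow> 'a set set \<Rightarrow> bool" where
  "maximal_clique_partition G P \<longleftrightarrow> clique_partition G P \<and>
     \<not> (\<exists>C\<in>P. \<exists>C'\<in>P. C \<noteq> C' \<and> clique G (C \<union> C'))"

end

theory Submission
  imports Defs
begin

text \<open>
  Choose for every class \<open>C\<close> of a maximal clique-partition a maximal clique containing \<open>C\<close>.
  By maximality distinct classes get distinct maximal cliques, so the classes are exactly the
  nonempty fibres of the map sending a vertex to the maximal clique chosen for its class.
  Hence every maximal clique-partition is the fibre partition of some choice of a maximal
  clique at each vertex.
\<close>

lemma clique_subset:
  assumes "clique G D" "C \<subseteq> D" "C \<noteq> {}"
  shows "clique G C"
  using assms unfolding clique_def by (meson pairwise_subset subset_trans)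

lemma finite_cliques:
  assumes "finite (verts G)"
  shows "finite {C. clique G C}"
  by (rule finite_subset[of _ "Pow (verts G)"]) (auto simp: clique_def assms)

lemma clique_extends_to_maximal_clique:
  assumes "finite (verts G)" "clique G C"
  shows "\<exists>M. maximal_clique G M \<and> C \<subseteq> M"
  using finite_has_maximal2[OF finite_cliques[OF assms(1)], of C] assms(2)
  unfolding maximal_clique_def by blast

text \<open>Indexing the fibres by points of \<open>V\<close> instead of by values excludes empty
  fibres, as the classes of a partition require.\<close>

definition fibres_on :: "'a set \<Rightarrow> ('a \<Rightarrow> 'b) \<Rightarrow> 'a set set" where
  "fibres_on V f = (\<lambda>v. {w \<in> V. f w = f v}) ` V"

text \<open>Taking \<open>f\<close> from an extensional product turns the count into a cardinality
  bound: that product is finite, and its size is the product of the numbers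
  \<open>d(v)\<close>.\<close>

lemma maximal_clique_partition_is_fibres:
  assumes fin: "finite (verts G)" and P: "maximal_clique_partition G P"
  shows "\<exists>f \<in> (\<Pi>\<^sub>E v\<in>verts G. {M. maximal_clique G M \<and> v \<in> M}). P = fibres_on (verts G) f"
proof -
  let ?V = "verts G"
  have part: "partition_on ?V P" and cl: "\<And>C. C \<in> P \<Longrightarrow> clique G C"
    and mx: "\<And>C C'. \<lbrakk>C \<in> P; C' \<in> P; clique G (C \<union> C')\<rbrakk> \<Longrightarrow> C = C'"
    using P by (auto simp: maximal_clique_partition_def clique_partition_def)
  have "\<forall>C\<in>P. \<exists>M. maximal_clique G M \<and> C \<subseteq> M"
    using clique_extends_to_maximal_clique[OF fin] cl by blast
  then obtain ext where ext: "\<And>C. C \<in> P \<Longrightarrow> maximal_clique G (ext C) \<and> C \<subseteq> ext C"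
    by metis
  \<comment> \<open>Two classes inside one common clique have a clique as their union, which
    maximality of \<open>P\<close> allows only if they coincide.\<close>
  have ext_inj: "C = C'" if "C \<in> P" "C' \<in> P" "ext C = ext C'" for C C'
  proof (rule mx[OF that(1,2)])
    show "clique G (C \<union> C')"
    proof (rule clique_subset)
      show "clique G (ext C)"
        using ext[OF that(1)] by (simp add: maximal_clique_def)
      show "C \<union> C' \<subseteq> ext C"
        using ext that by auto
      show "C \<union> C' \<noteq> {}"
        using cl[OF that(1)] by (auto simp: clique_def)
    qed
  qed
  have union: "\<Union>P = ?V" and nonempty: "{} \<notin> P"
    and disj: "\<And>C C' v. \<lbrakk>C \<in> P; C' \<in> P; v \<in> C; v \<in> C'\<rbrakk> \<Longrightarrow> C = C'"
    using part by (auto simp: partition_on_def disjoint_def)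
  have "\<forall>v\<in>?V. \<exists>C. C \<in> P \<and> v \<in> C"
    using union by blast
  then obtain cls where cls: "\<And>v. v \<in> ?V \<Longrightarrow> cls v \<in> P \<and> v \<in> cls v"
    by metis
  \<comment> \<open>\<open>restrict\<close> makes \<open>f\<close> extensional, as membership in
    \<open>\<Pi>\<^sub>E\<close> demands.\<close>
  define f where "f = restrict (\<lambda>v. ext (cls v)) ?V"
  \<comment> \<open>Injectivity of \<open>ext\<close> on \<open>P\<close> keeps a fibre from merging
    several classes; disjointness makes \<open>cls\<close>, and so \<open>f\<close>, constant on
    each class.\<close>
  have fibre: "{w \<in> ?V. f w = f v} = cls v" if v: "v \<in> ?V" for v
  proof (intro equalityI subsetI)
    fix w assume "w \<in> {w \<in> ?V. f w = f v}"
    then have "w \<in> ?V" "ext (cls w) = ext (cls v)"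
      using v by (auto simp: f_def)
    then show "w \<in> cls v"
      using ext_inj cls v by metis
  next
    fix w assume w: "w \<in> cls v"
    then have "w \<in> ?V"
      using union cls v by blast
    moreover from this have "cls w = cls v"
      using disj cls v w by metis
    ultimately show "w \<in> {w \<in> ?V. f w = f v}"
      using v by (simp add: f_def)
  qed
  have "P = cls ` ?V"
  proof (intro equalityI subsetI)
    fix C assume C: "C \<in> P"
    with nonempty obtain v where "v \<in> C"
      by (metis ex_in_conv)
    moreover from this have "v \<in> ?V"
      using union C by blast
    ultimately show "C \<in> cls ` ?V"
      using disj cls C by blast
  qed (use cls in auto)
  then have "P = fibres_on ?V f"
    unfolding fibres_on_def using fibre by simp
  moreover have "f \<in> (\<Pi>\<^sub>E v\<in>?V. {M. maximal_clique G M \<and> v \<in> M})"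
    using ext cls by (fastforce simp: f_def)
  ultimately show ?thesis
    by blast
qed

theorem theorem1:
  fixes G :: "('a, 'b) pre_digraph"
  assumes "graph G"
  shows "card {P. maximal_clique_partition G P} \<le> (\<Prod>v\<in>verts G. num_maximal_cliques_at G v)"
proof -
  interpret graph G by fact
  let ?F = "\<Pi>\<^sub>E v\<in>verts G. {M. maximal_clique G M \<and> v \<in> M}"
  have "finite {M. maximal_clique G M \<and> v \<in> M}" for v
    by (rule finite_subset[OF _ finite_cliques]) (auto simp: maximal_clique_def)
  then have "finite ?F"
    by (simp add: finite_PiE)
  \<comment> \<open>An inclusion suffices for the upper bound; the fibres of an arbitrary choice
    need not form a maximal clique-partition.\<close>
  moreover have "{P. maximal_clique_partition G P} \<subseteq> fibres_on (verts G) ` ?F"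
    using maximal_clique_partition_is_fibres[OF finite_verts] by blast
  ultimately have "card {P. maximal_clique_partition G P} \<le> card ?F"
    by (rule surj_card_le)
  also have "\<dots> = (\<Prod>v\<in>verts G. num_maximal_cliques_at G v)"
    by (simp add: card_PiE num_maximal_cliques_at_def)
  finally show ?thesis .
qed

end
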